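(* As formal power series, $$\begin{aligned}\Phi(x,y;J,O)={}&1+x e^{2y}+y e^{2x}+\frac{x^2}{2!}(1+y)^2e^{2y}+\frac{y^2}{2!}(1+x)^2e^{2x}\\&-\left(x+y+\frac{x^2}{2!}+\frac{y^2}{2!}+2xy+2x^2y+2xy^2+14\frac{x^2y^2}{2!2!}\right)+156\frac{x^3y^3}{3!3!}+840\frac{x^4y^4}{4!4!}\\&+720\left(\frac{x^3y^5}{3!5!}+\frac{x^5y^3}{5!3!}+\frac{x^3y^6}{3!6!}+\frac{x^6y^3}{6!3!}+\frac{x^4y^5}{4!5!}+\frac{x^5y^4}{5!4!}+\frac{x^4y^6}{4!6!}+\frac{x^6y^4}{6!4!}\right)\\&+408\left(\frac{x^3y^4}{3!4!}+\frac{x^4y^3}{4!3!}\right),\end{aligned}$$ and $$\Phi(z;J,O)=1+2z+7z^2+26z^3+35z^4.$$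
   Context: A $(0,1)$-matrix is a matrix with all entries in $\{0,1\}$. A $2\times2$ submatrix of a matrix is obtained by choosing two rows $i_1<i_2$ and two columns $j_1<j_2$. Let $J=\begin{pmatrix}1&1\\1&1\end{pmatrix}$ and $O=\begin{pmatrix}0&0\\0&0\end{pmatrix}$. For $k,n\ge1$, $\phi(k,n;J,O)$ is the number of $k\times n$ $(0,1)$-matrices having no $2\times2$ submatrix equal to $J$ or $O$. By convention $\phi(0,0;J,O)=1$ and $\phi(k,0;J,O)=\phi(0,n;J,O)=0$ for $k,n\ge1$. The generating functions are $\Phi(x,y;J,O)=\sum_{n\ge0}\sum_{k\ge0}\phi(k,n;J,O)\frac{x^k}{k!}\frac{y^n}{n!}$ and $\Phi(z;J,O)=\sum_{n\ge0}\phi(n,n;J,O)\frac{z^n}{n!}$. *)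

theory Defs
  imports
    "HOL-Computational_Algebra.Formal_Power_Series"
    "Jordan_Normal_Form.DL_Submatrix"
begin

definition zero_one_mats :: "nat \<Rightarrow> nat \<Rightarrow> nat mat set" where
  "zero_one_mats k n = {A \<in> carrier_mat k n. elements_mat A \<subseteq> {0, 1}}"

definition avoids :: "nat mat set \<Rightarrow> nat mat \<Rightarrow> bool" where
  "avoids F A \<longleftrightarrow>
     (\<forall>i1 i2 j1 j2. i1 < i2 \<longrightarrow> i2 < dim_row A \<longrightarrow> j1 < j2 \<longrightarrow> j2 < dim_col A \<longrightarrow>
        submatrix A {i1, i2} {j1, j2} \<notin> F)"

definition matJ :: "nat mat" where
  "matJ = mat 2 2 (\<lambda>_. 1)"

definition matO :: "nat mat" where
  "matO = 0\<^sub>m 2 2"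

text \<open>The values on empty matrices are a convention: the count itself would give 1
  whenever \<open>k = 0\<close> or \<open>n = 0\<close>.\<close>

definition phi :: "nat \<Rightarrow> nat \<Rightarrow> nat mat set \<Rightarrow> nat" where
  "phi k n F =
     (if k = 0 \<and> n = 0 then 1
      else if k = 0 \<or> n = 0 then 0
      else card {A \<in> zero_one_mats k n. avoids F A})"

text \<open>The ring of formal power series in \<open>x\<close> and \<open>y\<close> over the rationals is \<open>rat fps fps\<close>: the
  outer variable is \<open>x\<close>, and the coefficient of \<open>x^k\<close> is a series in \<open>y\<close>. The maps \<open>in_x\<close> and
  \<open>in_y\<close> embed univariate series as series in \<open>x\<close> alone and in \<open>y\<close> alone. Fractional constants
  go through \<open>scalar\<close>, because the coefficient ring \<open>rat fps\<close> is not a field.\<close>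

definition in_x :: "rat fps \<Rightarrow> rat fps fps" where
  "in_x f = Abs_fps (\<lambda>k. fps_const (fps_nth f k))"

definition in_y :: "rat fps \<Rightarrow> rat fps fps" where
  "in_y f = fps_const f"

definition scalar :: "rat \<Rightarrow> rat fps fps" where
  "scalar c = fps_const (fps_const c)"

definition Phi2 :: "nat mat set \<Rightarrow> rat fps fps" where
  "Phi2 F = Abs_fps (\<lambda>k. Abs_fps (\<lambda>n. of_nat (phi k n F) / (fact k * fact n)))"

definition Phi1 :: "nat mat set \<Rightarrow> rat fps" where
  "Phi1 F = Abs_fps (\<lambda>n. of_nat (phi n n F) / fact n)"

end

theory Submission
  imports Defs "HOL-Combinatorics.Multiset_Permutations"
begin

text \<open>
  A matrix is counted by \<open>phi\<close> exactly if the four entries at the crossing of two rows with two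
  columns are never all equal. Read column by column, this is a condition on pairs of columns
  (\<open>compatible\<close>), so \<open>phi k n\<close> is the number of sequences of \<open>n\<close> pairwise compatible columns of
  height \<open>k\<close> (\<open>phi_eq_card_sequences\<close>). Three regimes arise.

  With one row every two columns are compatible. With two rows the only conflicts are those of the
  two constant columns, each with itself; so each of them occurs at most once, and the count is
  \<open>2 ^ n\<close> times a quadratic polynomial in \<open>n\<close>. Together with the transposed counts
  (\<open>phi_commute\<close>) this yields the four terms with exponentials.

  With at least three rows every column repeats an entry and hence conflicts with itself. The columns
  of a matrix are then distinct, and \<open>phi k n\<close> is \<open>n!\<close> times the number of \<open>n\<close>-cliques in the
  compatibility graph on the \<open>2 ^ k\<close> columns (\<open>phi_eq_count_cliques\<close>). There are 26, 17, 6, 1, 0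
  cliques of sizes 3 to 7 for \<open>k = 3\<close>, there are 35, 6, 1 of sizes 4 to 6 for \<open>k = 4\<close>, and there is
  none of size 5 for \<open>k = 5\<close>. The two zeros propagate to all larger sizes (\<open>phi_eq_0_mono\<close>), so only
  finitely many monomials are left. On the diagonal the factor \<open>n!\<close> cancels, and the numbers 26
  and 35 become coefficients of the univariate series.

  The subtracted polynomial repairs the four exponential terms: they count the sizes with
  \<open>k, n \<in> {1, 2}\<close> twice, once by rows and once by columns, and they have nonzero coefficients at
  \<open>x\<close>, \<open>y\<close>, \<open>x^2\<close> and \<open>y^2\<close>, where \<open>phi\<close> is 0 by convention.
\<close>

section \<open>Monochromatic rectangles\<close>

lemma pick_pair:
  fixes i j :: nat
  assumes "i < j"
  shows "pick {i, j} 0 = i" and "pick {i, j} (Suc 0) = j"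
proof -
  show *: "pick {i, j} 0 = i"
    using assms by (auto intro!: Least_equality)
  show "pick {i, j} (Suc 0) = j"
    using assms unfolding pick.simps(2) * by (auto intro!: Least_equality)
qed

lemma submatrix_pair:
  assumes "i1 < i2" "i2 < dim_row A" "j1 < j2" "j2 < dim_col A"
  shows "submatrix A {i1, i2} {j1, j2} =
           mat 2 2 (\<lambda>(a, b). A $$ (if a = 0 then i1 else i2, if b = 0 then j1 else j2))"
proof -
  have "{i. i < dim_row A \<and> i \<in> {i1, i2}} = {i1, i2}" "{j. j < dim_col A \<and> j \<in> {j1, j2}} = {j1, j2}"
    using assms by auto
  hence card: "card {i. i < dim_row A \<and> i \<in> {i1, i2}} = 2" "card {j. j < dim_col A \<and> j \<in> {j1, j2}} = 2"
    using assms by simp_all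
  show ?thesis
    unfolding submatrix_def card
    by (rule cong_mat) (use assms pick_pair in \<open>auto simp: less_2_cases_iff\<close>)
qed

lemma zero_one_mats_iff:
  "A \<in> zero_one_mats k n \<longleftrightarrow> A \<in> carrier_mat k n \<and> (\<forall>i<k. \<forall>j<n. A $$ (i, j) = 0 \<or> A $$ (i, j) = 1)"
  unfolding zero_one_mats_def elements_mat_def
  by (simp add: UN_subset_iff image_subset_iff Ball_def cong: conj_cong)

lemma zero_one_mats_dim: "A \<in> zero_one_mats k n \<Longrightarrow> dim_row A = k \<and> dim_col A = n"
  by (auto simp: zero_one_mats_iff)

lemma zero_one_mats_entry:
  "A \<in> zero_one_mats k n \<Longrightarrow> i < k \<Longrightarrow> j < n \<Longrightarrow> A $$ (i, j) = 0 \<or> A $$ (i, j) = 1"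
  by (simp only: zero_one_mats_iff)

text \<open>Both forbidden submatrices are constant, and a constant \<open>2 \<times> 2\<close> submatrix of a 0-1 matrix
  is one of them. The condition can therefore be put in terms of equality of entries alone, which
  makes it visibly invariant under transposition.\<close>

definition rectangle_free_mats :: "nat \<Rightarrow> nat \<Rightarrow> nat mat set" where
  "rectangle_free_mats k n = {A \<in> zero_one_mats k n.
     \<forall>i1 i2 j1 j2. i1 < i2 \<longrightarrow> i2 < k \<longrightarrow> j1 < j2 \<longrightarrow> j2 < n \<longrightarrow>
       \<not> (A $$ (i1, j1) = A $$ (i1, j2) \<and> A $$ (i2, j1) = A $$ (i2, j2) \<and> A $$ (i1, j1) = A $$ (i2, j1))}"

lemma mat_2_2_eq_iff:
  "mat 2 2 f = mat 2 2 g \<longleftrightarrow>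
     f (0, 0) = g (0, 0) \<and> f (0, 1) = g (0, 1) \<and> f (1, 0) = g (1, 0) \<and> f (1, 1) = g (1, 1)"
  by (auto simp: mat_eq_iff less_2_cases_iff)

lemma phi_eq_card_rectangle_free:
  assumes "k > 0" "n > 0"
  shows "phi k n {matJ, matO} = card (rectangle_free_mats k n)"
proof -
  have "submatrix A {i1, i2} {j1, j2} \<in> {matJ, matO} \<longleftrightarrow>
      A $$ (i1, j1) = A $$ (i1, j2) \<and> A $$ (i2, j1) = A $$ (i2, j2) \<and> A $$ (i1, j1) = A $$ (i2, j1)"
    if "A \<in> zero_one_mats k n" "i1 < i2" "i2 < k" "j1 < j2" "j2 < n" for A i1 i2 j1 j2
  proof -
    have dim: "dim_row A = k" "dim_col A = n"
      using that(1) by (auto simp: zero_one_mats_iff)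
    have "A $$ (i1, j1) \<in> {0, 1}" "A $$ (i1, j2) \<in> {0, 1}" "A $$ (i2, j1) \<in> {0, 1}" "A $$ (i2, j2) \<in> {0, 1}"
      using that by (simp_all add: zero_one_mats_entry[OF that(1), simplified])
    thus ?thesis
      using that dim unfolding matJ_def matO_def zero_mat_def
      by (simp add: submatrix_pair mat_2_2_eq_iff) auto
  qed
  hence "{A \<in> zero_one_mats k n. avoids {matJ, matO} A} = rectangle_free_mats k n"
    unfolding rectangle_free_mats_def avoids_def
    by (intro Collect_cong conj_cong refl) (simp add: zero_one_mats_dim cong: imp_cong)
  thus ?thesis
    using assms by (simp add: phi_def)
qed

lemma transpose_rectangle_free:
  assumes "A \<in> rectangle_free_mats k n"
  shows "transpose_mat A \<in> rectangle_free_mats n k"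
proof -
  have A: "A \<in> zero_one_mats k n"
    using assms by (simp add: rectangle_free_mats_def)
  have free: "\<not> (A $$ (i1, j1) = A $$ (i1, j2) \<and> A $$ (i2, j1) = A $$ (i2, j2) \<and> A $$ (i1, j1) = A $$ (i2, j1))"
      if "i1 < i2" "i2 < k" "j1 < j2" "j2 < n" for i1 i2 j1 j2
    using assms that by (auto simp: rectangle_free_mats_def)
  have entry: "transpose_mat A $$ (i, j) = A $$ (j, i)" if "i < n" "j < k" for i j
    using that zero_one_mats_dim[OF A] by simp
  have "transpose_mat A \<in> zero_one_mats n k"
    using A by (auto simp: zero_one_mats_iff entry)
  moreover have "\<not> (transpose_mat A $$ (i1, j1) = transpose_mat A $$ (i1, j2) \<and>
      transpose_mat A $$ (i2, j1) = transpose_mat A $$ (i2, j2) \<and>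
      transpose_mat A $$ (i1, j1) = transpose_mat A $$ (i2, j1))"
    if "i1 < i2" "i2 < n" "j1 < j2" "j2 < k" for i1 i2 j1 j2
    using free[OF that(3,4,1,2)] that by (simp add: entry) metis
  ultimately show ?thesis
    unfolding rectangle_free_mats_def by blast
qed

lemma phi_commute: "phi k n {matJ, matO} = phi n k {matJ, matO}"
proof (cases "k = 0 \<or> n = 0")
  case False
  have "bij_betw transpose_mat (rectangle_free_mats k n) (rectangle_free_mats n k)"
    by (rule bij_betw_byWitness[where f' = transpose_mat]) (auto intro: transpose_rectangle_free)
  thus ?thesis
    using False by (simp add: phi_eq_card_rectangle_free bij_betw_same_card)
qed (auto simp: phi_def)

lemma finite_rectangle_free: "finite (rectangle_free_mats k n)"
proof (rule finite_subset)
  show "rectangle_free_mats k n \<subseteq> (\<lambda>f. mat k n f) ` (({..<k} \<times> {..<n}) \<rightarrow>\<^sub>E {0, 1})"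
  proof
    fix A assume "A \<in> rectangle_free_mats k n"
    hence A: "A \<in> zero_one_mats k n" by (simp add: rectangle_free_mats_def)
    have eq: "A = mat k n (restrict (\<lambda>p. A $$ p) ({..<k} \<times> {..<n}))"
      using A by (intro eq_matI) (auto simp: zero_one_mats_iff)
    have "restrict (\<lambda>p. A $$ p) ({..<k} \<times> {..<n}) \<in> ({..<k} \<times> {..<n}) \<rightarrow>\<^sub>E {0, 1}"
      using zero_one_mats_entry[OF A] by (simp add: PiE_iff del: One_nat_def)
    with eq show "A \<in> (\<lambda>f. mat k n f) ` (({..<k} \<times> {..<n}) \<rightarrow>\<^sub>E {0, 1})"
      by (rule image_eqI)
  qed
qed (intro finite_imageI finite_PiE; simp)

text \<open>Deleting rows and columns preserves rectangle-freeness.\<close>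

lemma phi_eq_0_mono:
  assumes "phi k n {matJ, matO} = 0" "0 < k" "k \<le> k'" "0 < n" "n \<le> n'"
  shows "phi k' n' {matJ, matO} = 0"
proof (rule ccontr)
  assume "phi k' n' {matJ, matO} \<noteq> 0"
  then obtain A where A: "A \<in> rectangle_free_mats k' n'"
    using assms by (fastforce simp: phi_eq_card_rectangle_free)
  have "mat k n (\<lambda>p. A $$ p) \<in> rectangle_free_mats k n"
    using A assms(3,5) unfolding rectangle_free_mats_def zero_one_mats_iff by auto
  thus False
    using assms finite_rectangle_free by (auto simp: phi_eq_card_rectangle_free)
qed

section \<open>Columns and their compatibility\<close>

text \<open>A pair in the zipped list is a row of the two-column matrix with columns \<open>c\<close> and \<open>d\<close>. The
  forbidden pattern is a row with two equal entries that occurs twice. The formulation by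
  \<open>sorted_wrt\<close> is executable.\<close>

definition compatible :: "'a list \<Rightarrow> 'a list \<Rightarrow> bool" where
  "compatible c d \<longleftrightarrow> sorted_wrt (\<lambda>p q. fst p = snd p \<longrightarrow> q \<noteq> p) (zip c d)"

lemma compatible_nth:
  assumes "length c = k" "length d = k"
  shows "compatible c d \<longleftrightarrow>
    (\<forall>i1 i2. i1 < i2 \<longrightarrow> i2 < k \<longrightarrow> c ! i1 = d ! i1 \<longrightarrow> \<not> (c ! i2 = c ! i1 \<and> d ! i2 = d ! i1))"
  using assms unfolding compatible_def sorted_wrt_iff_nth_less by simp

lemma compatible_sym:
  assumes len: "length c = length d" and cd: "compatible c d"
  shows "compatible d c"
  unfolding compatible_nth[OF refl len]
proof (intro allI impI notI)
  fix i1 i2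
  assume i: "i1 < i2" "i2 < length d" and "d ! i1 = c ! i1" "d ! i2 = d ! i1 \<and> c ! i2 = c ! i1"
  moreover have "c ! i1 = d ! i1 \<longrightarrow> \<not> (c ! i2 = c ! i1 \<and> d ! i2 = d ! i1)"
    using cd i unfolding compatible_nth[OF len refl] by blast
  ultimately show False by simp
qed

definition sequences :: "('a \<Rightarrow> 'a \<Rightarrow> bool) \<Rightarrow> nat \<Rightarrow> 'a set \<Rightarrow> 'a list set" where
  "sequences R n S = {cs. length cs = n \<and> set cs \<subseteq> S \<and> sorted_wrt R cs}"

lemma phi_eq_card_sequences:
  assumes "k > 0" "n > 0"
  shows "phi k n {matJ, matO} = card (sequences compatible n {c :: bool list. length c = k})"
proof -
  let ?cols = "\<lambda>A :: nat mat. map (\<lambda>j. map (\<lambda>i. A $$ (i, j) = 1) [0..<k]) [0..<n]"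
  let ?mat = "\<lambda>cs. mat k n (\<lambda>(i, j). of_bool (cs ! j ! i) :: nat)"
  have "bij_betw ?cols (rectangle_free_mats k n) (sequences compatible n {c :: bool list. length c = k})"
  proof (rule bij_betw_byWitness[where f' = ?mat])
    show "\<forall>A \<in> rectangle_free_mats k n. ?mat (?cols A) = A"
    proof
      fix A assume "A \<in> rectangle_free_mats k n"
      hence A: "A \<in> zero_one_mats k n" by (simp add: rectangle_free_mats_def)
      show "?mat (?cols A) = A"
      proof (rule eq_matI)
        fix i j assume "i < dim_row A" "j < dim_col A"
        thus "?mat (?cols A) $$ (i, j) = A $$ (i, j)"
          using zero_one_mats_dim[OF A] zero_one_mats_entry[OF A, of i j] by (cases "A $$ (i, j) = 1") auto
      qed (use zero_one_mats_dim[OF A] in simp_all)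
    qed
    show "\<forall>cs \<in> sequences compatible n {c :: bool list. length c = k}. ?cols (?mat cs) = cs"
    proof
      fix cs assume "cs \<in> sequences compatible n {c :: bool list. length c = k}"
      hence "length cs = n" and "\<And>j. j < n \<Longrightarrow> length (cs ! j) = k"
        by (auto simp: sequences_def dest: nth_mem)
      thus "?cols (?mat cs) = cs"
        by (auto intro!: nth_equalityI simp: of_bool_def split: if_splits)
    qed
    show "?cols ` rectangle_free_mats k n \<subseteq> sequences compatible n {c :: bool list. length c = k}"
    proof clarify
      fix A assume A: "A \<in> rectangle_free_mats k n"
      have "sorted_wrt compatible (?cols A)"
        unfolding sorted_wrt_iff_nth_less
      proof (intro allI impI)
        fix j1 j2 assume j: "j1 < j2" "j2 < length (?cols A)"
        have "\<not> ((A $$ (i1, j1) = 1) = (A $$ (i1, j2) = 1) \<and> (A $$ (i2, j1) = 1) = (A $$ (i2, j2) = 1) \<and>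
          (A $$ (i1, j1) = 1) = (A $$ (i2, j1) = 1))" if "i1 < i2" "i2 < k" for i1 i2
        proof -
          have "A \<in> zero_one_mats k n" using A by (simp add: rectangle_free_mats_def)
          hence "A $$ (i1, j1) \<in> {0, 1}" "A $$ (i1, j2) \<in> {0, 1}" "A $$ (i2, j1) \<in> {0, 1}" "A $$ (i2, j2) \<in> {0, 1}"
            using that j by (simp_all add: zero_one_mats_entry[simplified])
          moreover have "\<not> (A $$ (i1, j1) = A $$ (i1, j2) \<and> A $$ (i2, j1) = A $$ (i2, j2) \<and> A $$ (i1, j1) = A $$ (i2, j1))"
            using A that j by (auto simp: rectangle_free_mats_def)
          ultimately show ?thesis by auto
        qed
        thus "compatible (?cols A ! j1) (?cols A ! j2)"
          using j by (subst compatible_nth[of _ k]) auto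
      qed
      thus "?cols A \<in> sequences compatible n {c :: bool list. length c = k}"
        by (auto simp: sequences_def)
    qed
    show "?mat ` sequences compatible n {c :: bool list. length c = k} \<subseteq> rectangle_free_mats k n"
    proof clarify
      fix cs assume cs: "cs \<in> sequences compatible n {c :: bool list. length c = k}"
      have "\<not> ((cs ! j1 ! i1 = cs ! j2 ! i1) \<and> (cs ! j1 ! i2 = cs ! j2 ! i2) \<and> (cs ! j1 ! i1 = cs ! j1 ! i2))"
        if "i1 < i2" "i2 < k" "j1 < j2" "j2 < n" for i1 i2 j1 j2
      proof -
        have "length (cs ! j1) = k" "length (cs ! j2) = k" "compatible (cs ! j1) (cs ! j2)"
          using cs that by (auto simp: sequences_def sorted_wrt_iff_nth_less subset_iff)
        hence "cs ! j1 ! i1 = cs ! j2 ! i1 \<longrightarrow> \<not> (cs ! j1 ! i2 = cs ! j1 ! i1 \<and> cs ! j2 ! i2 = cs ! j2 ! i1)"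
          using that compatible_nth by blast
        thus ?thesis by auto
      qed
      thus "?mat cs \<in> rectangle_free_mats k n"
        unfolding rectangle_free_mats_def zero_one_mats_iff by (auto simp: of_bool_def)
    qed
  qed
  thus ?thesis
    using assms by (simp add: phi_eq_card_rectangle_free bij_betw_same_card)
qed

lemma finite_sequences: "finite S \<Longrightarrow> finite (sequences R n S)"
  by (rule finite_subset[OF _ finite_lists_length_eq[of S n]]) (auto simp: sequences_def)

lemma card_sequences_0: "card (sequences R 0 S) = 1"
proof -
  have "sequences R 0 S = {[]}" by (auto simp: sequences_def)
  thus ?thesis by simp
qed

text \<open>Fixing the first entry \<open>c\<close> confines the later ones to the elements that follow \<open>c\<close> under \<open>R\<close>.\<close>

lemma card_sequences_Suc:
  assumes "finite S"
  shows "card (sequences R (Suc n) S) = (\<Sum>c\<in>S. card (sequences R n {d \<in> S. R c d}))"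
proof -
  have "cs \<in> sequences R (Suc n) S \<longleftrightarrow> cs \<in> (\<Union>c\<in>S. Cons c ` sequences R n {d \<in> S. R c d})" for cs
    by (cases cs) (auto simp: sequences_def image_iff)
  hence "sequences R (Suc n) S = (\<Union>c\<in>S. Cons c ` sequences R n {d \<in> S. R c d})"
    by blast
  moreover have "card \<dots> = (\<Sum>c\<in>S. card (Cons c ` sequences R n {d \<in> S. R c d}))"
    using assms by (intro card_UN_disjoint) (auto intro!: finite_imageI finite_sequences)
  ultimately show ?thesis by (simp add: card_image)
qed

section \<open>One or two rows\<close>

lemma phi_1:
  assumes "n > 0"
  shows "phi 1 n {matJ, matO} = 2 ^ n"
proof -
  have "{c :: bool list. length c = 1} = {[False], [True]}"
    by (auto simp: length_Suc_conv)
  moreover have "card (sequences compatible n {[False], [True]}) = 2 ^ n"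
  proof (induction n)
    case (Suc n)
    have "{d \<in> {[False], [True]}. compatible c d} = {[False], [True]}" if "c \<in> {[False], [True]}" for c
      using that by (auto simp: compatible_def)
    with Suc show ?case
      by (simp add: card_sequences_Suc cong: sum.cong_simp)
  qed (rule card_sequences_0[THEN trans], simp)
  ultimately show ?thesis
    using assms by (simp add: phi_eq_card_sequences)
qed

text \<open>A constant column, once used, is unavailable from then on, and no other restriction exists. The
  recursion thus passes through four sets of available columns: the two mixed columns together with
  any subset of the two constant ones.\<close>

lemma phi_2:
  assumes "n > 0"
  shows "4 * phi 2 n {matJ, matO} = 2 ^ n * (n\<^sup>2 + 3 * n + 4)"
proof -
  let ?FF = "[False, False]" and ?TT = "[True, True]" and ?M = "{[False, True], [True, False]}"
  let ?N = "\<lambda>n S. card (sequences compatible n S)"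
  have restrict:
    "{d \<in> ?M. compatible [False, True] d} = ?M"
    "{d \<in> ?M. compatible [True, False] d} = ?M"
    "{d \<in> insert ?FF ?M. compatible [False, True] d} = insert ?FF ?M"
    "{d \<in> insert ?FF ?M. compatible [True, False] d} = insert ?FF ?M"
    "{d \<in> insert ?FF ?M. compatible ?FF d} = ?M"
    "{d \<in> insert ?TT ?M. compatible [False, True] d} = insert ?TT ?M"
    "{d \<in> insert ?TT ?M. compatible [True, False] d} = insert ?TT ?M"
    "{d \<in> insert ?TT ?M. compatible ?TT d} = ?M"
    "{d \<in> insert ?FF (insert ?TT ?M). compatible [False, True] d} = insert ?FF (insert ?TT ?M)"
    "{d \<in> insert ?FF (insert ?TT ?M). compatible [True, False] d} = insert ?FF (insert ?TT ?M)"
    "{d \<in> insert ?FF (insert ?TT ?M). compatible ?FF d} = insert ?TT ?M"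
    "{d \<in> insert ?FF (insert ?TT ?M). compatible ?TT d} = insert ?FF ?M"
    by (auto simp: compatible_def)
  have M: "?N n ?M = 2 ^ n" for n
  proof (induction n)
    case (Suc n)
    have "?N (Suc n) ?M =
        ?N n {d \<in> ?M. compatible [False, True] d} +
        ?N n {d \<in> ?M. compatible [True, False] d}"
      by (subst card_sequences_Suc) simp_all
    also have "\<dots> = 2 * ?N n ?M"
      unfolding restrict by simp
    finally have "?N (Suc n) ?M = \<dots>" .
    with Suc show ?case by simp
  qed (simp only: card_sequences_0 power_0)
  have FF: "2 * ?N n (insert ?FF ?M) = 2 ^ n * (n + 2)" for n
  proof (induction n)
    case (Suc n)
    have "?N (Suc n) (insert ?FF ?M) =
        ?N n {d \<in> insert ?FF ?M. compatible ?FF d} +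
        ?N n {d \<in> insert ?FF ?M. compatible [False, True] d} +
        ?N n {d \<in> insert ?FF ?M. compatible [True, False] d}"
      by (subst card_sequences_Suc) simp_all
    also have "\<dots> = ?N n ?M + 2 * ?N n (insert ?FF ?M)"
      unfolding restrict by simp
    finally have "?N (Suc n) (insert ?FF ?M) = \<dots>" .
    with Suc show ?case by (simp add: M algebra_simps)
  qed (simp only: card_sequences_0, simp)
  have TT: "2 * ?N n (insert ?TT ?M) = 2 ^ n * (n + 2)" for n
  proof (induction n)
    case (Suc n)
    have "?N (Suc n) (insert ?TT ?M) =
        ?N n {d \<in> insert ?TT ?M. compatible ?TT d} +
        ?N n {d \<in> insert ?TT ?M. compatible [False, True] d} +
        ?N n {d \<in> insert ?TT ?M. compatible [True, False] d}"
      by (subst card_sequences_Suc) simp_all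
    also have "\<dots> = ?N n ?M + 2 * ?N n (insert ?TT ?M)"
      unfolding restrict by simp
    finally have "?N (Suc n) (insert ?TT ?M) = \<dots>" .
    with Suc show ?case by (simp add: M algebra_simps)
  qed (simp only: card_sequences_0, simp)
  have "4 * ?N n (insert ?FF (insert ?TT ?M)) = 2 ^ n * (n\<^sup>2 + 3 * n + 4)" for n
  proof (induction n)
    case (Suc n)
    have "?N (Suc n) (insert ?FF (insert ?TT ?M)) =
        ?N n {d \<in> insert ?FF (insert ?TT ?M). compatible ?FF d} +
        ?N n {d \<in> insert ?FF (insert ?TT ?M). compatible ?TT d} +
        ?N n {d \<in> insert ?FF (insert ?TT ?M). compatible [False, True] d} +
        ?N n {d \<in> insert ?FF (insert ?TT ?M). compatible [True, False] d}"
      by (subst card_sequences_Suc) simp_all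
    also have "\<dots> = ?N n (insert ?TT ?M) + ?N n (insert ?FF ?M) + 2 * ?N n (insert ?FF (insert ?TT ?M))"
      unfolding restrict by simp
    finally have "?N (Suc n) (insert ?FF (insert ?TT ?M)) = \<dots>" .
    with Suc FF[of n] TT[of n] show ?case by (simp add: algebra_simps power2_eq_square)
  qed (simp only: card_sequences_0, simp)
  moreover have "{c :: bool list. length c = 2} = insert ?FF (insert ?TT ?M)"
    by (auto simp: length_Suc_conv numeral_2_eq_2)
  ultimately show ?thesis
    using assms by (simp add: phi_eq_card_sequences)
qed

section \<open>Three or more rows: cliques\<close>

definition cliques :: "('a \<Rightarrow> 'a \<Rightarrow> bool) \<Rightarrow> nat \<Rightarrow> 'a set \<Rightarrow> 'a set set" where
  "cliques R n S = {C. C \<subseteq> S \<and> card C = n \<and> pairwise R C}"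

text \<open>By irreflexivity a sequence has no repetition, so it is a clique together with one of the
  \<open>n!\<close> arrangements of its elements.\<close>

lemma card_sequences_eq_cliques:
  assumes fin: "finite S" and irrefl: "\<And>c. c \<in> S \<Longrightarrow> \<not> R c c"
    and sym: "\<And>c d. c \<in> S \<Longrightarrow> d \<in> S \<Longrightarrow> R c d \<Longrightarrow> R d c"
  shows "card (sequences R n S) = fact n * card (cliques R n S)"
proof -
  have dist: "distinct cs" if "set cs \<subseteq> S" "sorted_wrt R cs" for cs
    using that by (induction cs) (use irrefl in auto)
  have iff: "sorted_wrt R cs \<longleftrightarrow> pairwise R (set cs)" if "set cs \<subseteq> S" "distinct cs" for cs
    using that
  proof (induction cs)
    case (Cons c cs)
    hence "pairwise R (set (c # cs)) \<longleftrightarrow> (\<forall>d\<in>set cs. R c d) \<and> pairwise R (set cs)"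
      using sym by (auto simp: pairwise_insert)
    with Cons show ?case by simp
  qed auto
  have "cs \<in> sequences R n S \<longleftrightarrow> cs \<in> (\<Union>C\<in>cliques R n S. permutations_of_set C)" for cs
    using dist[of cs] iff[of cs] distinct_card[of cs]
    by (auto simp: sequences_def cliques_def permutations_of_set_def)
  hence "sequences R n S = (\<Union>C\<in>cliques R n S. permutations_of_set C)"
    by blast
  also have "card \<dots> = (\<Sum>C\<in>cliques R n S. card (permutations_of_set C))"
  proof (rule card_UN_disjoint)
    show "finite (cliques R n S)"
      using fin by (auto simp: cliques_def intro: finite_subset[of _ "Pow S"])
  qed (simp_all, auto simp: permutations_of_set_def)
  also have "\<dots> = (\<Sum>C\<in>cliques R n S. fact n)"
    by (intro sum.cong) (auto simp: cliques_def finite_subset[OF _ fin])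
  finally show ?thesis by simp
qed

fun count_cliques :: "('a \<Rightarrow> 'a \<Rightarrow> bool) \<Rightarrow> nat \<Rightarrow> 'a list \<Rightarrow> nat" where
  "count_cliques R 0 vs = 1"
| "count_cliques R (Suc n) [] = 0"
| "count_cliques R (Suc n) (v # vs) =
     count_cliques R (Suc n) vs + count_cliques R n (filter (R v) vs)"

text \<open>A clique in \<open>v # vs\<close> either misses \<open>v\<close> or consists of \<open>v\<close> and a clique among its neighbours.
  Each clique is met once, in the order of the list, which keeps the evaluation small: the search
  visits cliques instead of their \<open>n!\<close> arrangements.\<close>

lemma card_cliques:
  assumes "distinct vs" "\<And>c d. c \<in> set vs \<Longrightarrow> d \<in> set vs \<Longrightarrow> R c d \<Longrightarrow> R d c"
  shows "card (cliques R n (set vs)) = count_cliques R n vs"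
  using assms
proof (induction R n vs rule: count_cliques.induct)
  case (1 R vs)
  have "cliques R 0 (set vs) = {{}}"
    by (auto simp: cliques_def dest: finite_subset)
  thus ?case by simp
next
  case (2 R n)
  have "cliques R (Suc n) (set []) = {}"
    by (auto simp: cliques_def)
  thus ?case by simp
next
  case (3 R n v vs)
  let ?N = "set (filter (R v) vs)"
  have fin: "finite C" if "C \<subseteq> set xs" for C and xs :: "'a list"
    using that finite_subset by blast
  have split: "cliques R (Suc n) (set (v # vs)) = cliques R (Suc n) (set vs) \<union> insert v ` cliques R n ?N"
  proof (intro equalityI subsetI)
    fix C assume C: "C \<in> cliques R (Suc n) (set (v # vs))"
    show "C \<in> cliques R (Suc n) (set vs) \<union> insert v ` cliques R n ?N"
    proof (cases "v \<in> C")
      case True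
      have "C - {v} \<in> cliques R n ?N"
        using C True by (auto simp: cliques_def pairwise_def)
      moreover have "C = insert v (C - {v})" using True by blast
      ultimately show ?thesis by blast
    qed (use C in \<open>auto simp: cliques_def\<close>)
  next
    fix C assume "C \<in> cliques R (Suc n) (set vs) \<union> insert v ` cliques R n ?N"
    thus "C \<in> cliques R (Suc n) (set (v # vs))"
    proof
      assume "C \<in> insert v ` cliques R n ?N"
      then obtain D where D: "D \<subseteq> ?N" "card D = n" "pairwise R D" "C = insert v D"
        by (auto simp: cliques_def)
      have "v \<notin> D" "finite D" using D(1) 3(3) fin[of D "filter (R v) vs"] by auto
      thus ?thesis using D 3(4) by (auto simp: cliques_def pairwise_insert)
    qed (auto simp: cliques_def)
  qed
  have "inj_on (insert v) (cliques R n ?N)"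
    using 3(3) by (intro inj_onI) (auto simp: cliques_def dest!: insert_ident[THEN iffD1, rotated 2])
  moreover have "cliques R (Suc n) (set vs) \<inter> insert v ` cliques R n ?N = {}"
    using 3(3) by (auto simp: cliques_def)
  moreover have "finite (cliques R m (set xs))" for m and xs :: "'a list"
    by (rule finite_subset[of _ "Pow (set xs)"]) (auto simp: cliques_def)
  ultimately have "card (cliques R (Suc n) (set (v # vs))) =
      card (cliques R (Suc n) (set vs)) + card (cliques R n ?N)"
    unfolding split by (subst card_Un_disjoint) (auto simp: card_image simp del: set_filter)
  moreover have "card (cliques R (Suc n) (set vs)) = count_cliques R (Suc n) vs"
    using 3(3,4) by (intro 3(1)) auto
  moreover have "card (cliques R n ?N) = count_cliques R n (filter (R v) vs)"
    using 3(3,4) by (intro 3(2)) auto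
  ultimately show ?case
    by (simp only: count_cliques.simps)
qed

text \<open>Two of the first three entries of a column agree, by the pigeonhole principle.\<close>

lemma not_compatible_self:
  assumes "length c \<ge> 3"
  shows "\<not> compatible c (c :: bool list)"
proof
  assume "compatible c c"
  hence *: "c ! i \<noteq> c ! j" if "i < j" "j < length c" for i j
    using that by (auto simp: compatible_nth[OF refl refl])
  show False
    using *[of 0 1] *[of 0 2] *[of 1 2] assms by auto
qed

lemma phi_eq_count_cliques:
  assumes "k \<ge> 3" "n > 0"
  shows "phi k n {matJ, matO} = fact n * count_cliques compatible n (List.n_lists k [False, True])"
proof -
  have set: "{c :: bool list. length c = k} = set (List.n_lists k [False, True])"
    by (auto simp: set_n_lists)
  have fin: "finite {c :: bool list. length c = k}"
    unfolding set by simp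
  have "phi k n {matJ, matO} = card (sequences compatible n (set (List.n_lists k [False, True])))"
    using assms by (simp add: phi_eq_card_sequences set)
  also have "\<dots> = fact n * card (cliques compatible n (set (List.n_lists k [False, True])))"
    using assms by (intro card_sequences_eq_cliques)
      (auto simp: fin not_compatible_self compatible_sym simp flip: set)
  also have "\<dots> = fact n * count_cliques compatible n (List.n_lists k [False, True])"
    by (subst card_cliques) (auto simp: distinct_n_lists compatible_sym simp flip: set)
  finally show ?thesis .
qed

text \<open>The clique counts for \<open>k = 3\<close> can be seen directly: the six nonconstant columns are pairwise
  compatible and give \<open>6 choose n\<close> cliques; each constant column is compatible with exactly three
  of them, the two constant columns have no common neighbour, and so each adds \<open>3 choose (n - 1)\<close>
  cliques for \<open>n \<ge> 3\<close>. For \<open>k = 4\<close>, the six columns with two ones are pairwise compatible and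
  account for the single clique of size 6.\<close>

lemma phi_table:
  "phi 3 3 {matJ, matO} = 156" "phi 3 4 {matJ, matO} = 408" "phi 3 5 {matJ, matO} = 720"
  "phi 3 6 {matJ, matO} = 720" "phi 4 4 {matJ, matO} = 840" "phi 4 5 {matJ, matO} = 720"
  "phi 4 6 {matJ, matO} = 720" "phi 3 7 {matJ, matO} = 0" "phi 5 5 {matJ, matO} = 0"
proof -
  have "map (\<lambda>n. count_cliques compatible n (List.n_lists 3 [False, True])) [3, 4, 5, 6, 7] =
      [26, 17, 6, 1, 0]"
    by code_simp
  moreover have "map (\<lambda>n. count_cliques compatible n (List.n_lists 4 [False, True])) [4, 5, 6] =
      [35, 6, 1]"
    by code_simp
  moreover have "count_cliques compatible 5 (List.n_lists 5 [False, True]) = 0"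
    by code_simp
  ultimately show
    "phi 3 3 {matJ, matO} = 156" "phi 3 4 {matJ, matO} = 408" "phi 3 5 {matJ, matO} = 720"
    "phi 3 6 {matJ, matO} = 720" "phi 4 4 {matJ, matO} = 840" "phi 4 5 {matJ, matO} = 720"
    "phi 4 6 {matJ, matO} = 720" "phi 3 7 {matJ, matO} = 0" "phi 5 5 {matJ, matO} = 0"
    by (simp_all add: phi_eq_count_cliques fact_numeral del: List.n_lists.simps)
qed

lemma phi_eq_0:
  assumes "3 \<le> k" "3 \<le> n" "6 < k \<or> 6 < n \<or> (4 < k \<and> 4 < n)"
  shows "phi k n {matJ, matO} = 0"
proof -
  have "phi 7 3 {matJ, matO} = 0"
    by (subst phi_commute) (rule phi_table)
  with assms show ?thesis
    using phi_eq_0_mono[of 7 3 k n] phi_eq_0_mono[of 3 7 k n] phi_eq_0_mono[of 5 5 k n]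
    by (auto simp: phi_table)
qed

section \<open>Coefficient comparison\<close>

lemma in_x_mult: "in_x (f * g) = in_x f * in_x g"
proof -
  have "fps_const (sum h S) = (\<Sum>i\<in>S. fps_const (h i))" for h :: "nat \<Rightarrow> rat" and S
    by (rule fps_ext) (simp add: fps_sum_nth)
  thus ?thesis
    by (intro fps_ext) (simp add: in_x_def fps_mult_nth)
qed

lemma in_x_power: "in_x (f ^ m) = in_x f ^ m"
proof (induction m)
  case 0
  show ?case by (rule fps_ext) (simp add: in_x_def)
qed (simp add: in_x_mult)

lemma in_x_1_plus: "in_x (1 + f) = 1 + in_x f"
proof (rule fps_ext)
  show "fps_nth (in_x (1 + f)) k = fps_nth (1 + in_x f) k" for k
    by (cases k) (simp_all add: in_x_def flip: fps_const_add)
qed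

lemma in_y_mult: "in_y (f * g) = in_y f * in_y g"
  by (simp add: in_y_def)

lemma in_y_power: "in_y (f ^ m) = in_y f ^ m"
  by (induction m) (simp_all add: in_y_def)

lemma in_y_1_plus: "in_y (1 + f) = 1 + in_y f"
  by (simp add: in_y_def flip: fps_const_add)

lemma nth_scalar_mult: "fps_nth (fps_nth (scalar c * F) k) n = c * fps_nth (fps_nth F k) n"
  by (simp add: scalar_def)

text \<open>A product of a series in \<open>x\<close> and a series in \<open>y\<close> has the products of their coefficients as
  coefficients. Every summand of the claimed series is a scalar multiple of such a product, so the
  preceding homomorphism rules reduce all coefficient computations to this one.\<close>

lemma nth_in_x_mult_in_y: "fps_nth (fps_nth (in_x f * in_y g) k) n = fps_nth f k * fps_nth g n"
  by (simp add: in_x_def in_y_def)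

lemma nth_numeral_mult:
  "fps_nth (fps_nth (numeral m * F) k) n = (numeral m * fps_nth (fps_nth F k) n :: rat)"
  by (simp add: numeral_fps_const)

lemma nth_monomial:
  "fps_nth (fps_nth (in_x fps_X ^ a * in_y fps_X ^ b) k) n = (if k = a \<and> n = b then 1 else 0)"
  by (simp flip: in_x_power in_y_power add: nth_in_x_mult_in_y)

text \<open>This is the exponential generating function of the two-row counts, without the factor
  \<open>1 / 2!\<close>; compare \<open>phi_2\<close>.\<close>

lemma nth_square_mult_exp:
  "fps_nth ((1 + fps_X)\<^sup>2 * fps_exp 2) n = (2 ^ n * (of_nat n ^ 2 + 3 * of_nat n + 4) / (4 * fact n) :: rat)"
proof -
  have *: "(1 + fps_X)\<^sup>2 * fps_exp 2 = fps_exp 2 + fps_const 2 * (fps_X * fps_exp 2) + fps_X * (fps_X * fps_exp (2::rat))"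
    by (simp add: power2_eq_square algebra_simps flip: numeral_fps_const)
  consider "n = 0" | "n = 1" | m where "n = Suc (Suc m)"
    by (metis One_nat_def nat.exhaust)
  thus ?thesis
  proof cases
    case (3 m)
    show ?thesis
    proof -
      have "of_nat (Suc m) \<noteq> (0 :: rat)" "of_nat (Suc (Suc m)) \<noteq> (0 :: rat)"
        by (simp_all only: of_nat_eq_0_iff)
      hence nz: "1 + of_nat m \<noteq> (0 :: rat)" "2 + of_nat m \<noteq> (0 :: rat)"
        by (simp_all add: add_ac)
      have "fact (Suc m) = (1 + of_nat m) * (fact m :: rat)"
        "fact (Suc (Suc m)) = (2 + of_nat m) * (1 + of_nat m) * (fact m :: rat)"
        by (simp_all add: algebra_simps)
      thus ?thesis
        unfolding * 3 using nz by (simp add: divide_simps del: fact_Suc) (simp add: algebra_simps power2_eq_square)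
    qed
  qed (simp_all add: *)
qed

lemma fps_fps_ext: "(\<And>k n. fps_nth (fps_nth F k) n = fps_nth (fps_nth G k) n) \<Longrightarrow> F = G"
  by (intro fps_ext)

theorem mainTheorem11:
  fixes x y :: "rat fps fps" and z :: "rat fps"
  defines "x \<equiv> in_x fps_X" and "y \<equiv> in_y fps_X" and "z \<equiv> fps_X"
  shows "Phi2 {matJ, matO} =
           1 + x * in_y (fps_exp 2) + y * in_x (fps_exp 2)
           + scalar (1 / fact 2) * x^2 * (1 + y)^2 * in_y (fps_exp 2)
           + scalar (1 / fact 2) * y^2 * (1 + x)^2 * in_x (fps_exp 2)
           - (x + y + scalar (1 / fact 2) * x^2 + scalar (1 / fact 2) * y^2
              + 2 * x * y + 2 * x^2 * y + 2 * x * y^2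
              + scalar (14 / (fact 2 * fact 2)) * x^2 * y^2)
           + scalar (156 / (fact 3 * fact 3)) * x^3 * y^3
           + scalar (840 / (fact 4 * fact 4)) * x^4 * y^4
           + 720 * (scalar (1 / (fact 3 * fact 5)) * x^3 * y^5
                    + scalar (1 / (fact 5 * fact 3)) * x^5 * y^3
                    + scalar (1 / (fact 3 * fact 6)) * x^3 * y^6
                    + scalar (1 / (fact 6 * fact 3)) * x^6 * y^3
                    + scalar (1 / (fact 4 * fact 5)) * x^4 * y^5
                    + scalar (1 / (fact 5 * fact 4)) * x^5 * y^4
                    + scalar (1 / (fact 4 * fact 6)) * x^4 * y^6
                    + scalar (1 / (fact 6 * fact 4)) * x^6 * y^4)
           + 408 * (scalar (1 / (fact 3 * fact 4)) * x^3 * y^4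
                    + scalar (1 / (fact 4 * fact 3)) * x^4 * y^3)
         \<and> Phi1 {matJ, matO} = 1 + 2 * z + 7 * z^2 + 26 * z^3 + 35 * z^4"
proof (rule conjI, rule fps_fps_ext, goal_cases)
  case (1 k n)
  let ?X = "in_x fps_X" and ?Y = "in_y fps_X"
  have monomials:
    "fps_nth (fps_nth ?X k) n = (if k = 1 \<and> n = 0 then 1 else 0)"
    "fps_nth (fps_nth ?Y k) n = (if k = 0 \<and> n = 1 then 1 else 0)"
    "fps_nth (fps_nth (scalar c * ?X\<^sup>2) k) n = (if k = 2 \<and> n = 0 then c else 0)"
    "fps_nth (fps_nth (scalar c * ?Y\<^sup>2) k) n = (if k = 0 \<and> n = 2 then c else 0)"
    "fps_nth (fps_nth (scalar c * ?X ^ a * ?Y ^ b) k) n = (if k = a \<and> n = b then c else 0)"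
    "fps_nth (fps_nth (numeral m * ?X * ?Y) k) n = (if k = 1 \<and> n = 1 then numeral m else 0)"
    "fps_nth (fps_nth (numeral m * ?X\<^sup>2 * ?Y) k) n = (if k = 2 \<and> n = 1 then numeral m else 0)"
    "fps_nth (fps_nth (numeral m * ?X * ?Y\<^sup>2) k) n = (if k = 1 \<and> n = 2 then numeral m else 0)"
    for c a b m
    using nth_monomial[of 1 0 k n] nth_monomial[of 0 1 k n] nth_monomial[of 2 0 k n] nth_monomial[of 0 2 k n]
      nth_monomial[of a b k n] nth_monomial[of 1 1 k n] nth_monomial[of 2 1 k n] nth_monomial[of 1 2 k n]
    by (simp_all add: nth_scalar_mult nth_numeral_mult mult.assoc)
  have "?Y * in_x (fps_exp 2) = in_x (fps_exp 2) * in_y fps_X"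
    "scalar c * ?X\<^sup>2 * (1 + ?Y)\<^sup>2 * in_y (fps_exp 2) =
      scalar c * (in_x (fps_X\<^sup>2) * in_y ((1 + fps_X)\<^sup>2 * fps_exp 2))"
    "scalar c * ?Y\<^sup>2 * (1 + ?X)\<^sup>2 * in_x (fps_exp 2) =
      scalar c * (in_x ((1 + fps_X)\<^sup>2 * fps_exp 2) * in_y (fps_X\<^sup>2))" for c
    by (simp_all add: in_x_mult in_y_mult in_x_power in_y_power in_x_1_plus in_y_1_plus mult_ac)
  hence exponentials:
    "fps_nth (fps_nth (?X * in_y (fps_exp 2)) k) n = (if k = 1 then 2 ^ n / fact n else 0)"
    "fps_nth (fps_nth (?Y * in_x (fps_exp 2)) k) n = (if n = 1 then 2 ^ k / fact k else 0)"
    "fps_nth (fps_nth (scalar c * ?X\<^sup>2 * (1 + ?Y)\<^sup>2 * in_y (fps_exp 2)) k) n =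
      (if k = 2 then c * (2 ^ n * (of_nat n ^ 2 + 3 * of_nat n + 4) / (4 * fact n)) else 0)"
    "fps_nth (fps_nth (scalar c * ?Y\<^sup>2 * (1 + ?X)\<^sup>2 * in_x (fps_exp 2)) k) n =
      (if n = 2 then c * (2 ^ k * (of_nat k ^ 2 + 3 * of_nat k + 4) / (4 * fact k)) else 0)" for c
    by (simp_all only: nth_scalar_mult nth_in_x_mult_in_y nth_square_mult_exp)
      (simp_all add: fps_X_nth)
  have one: "fps_nth (fps_nth (1 :: rat fps fps) k) n = (if k = 0 \<and> n = 0 then 1 else 0)"
    by simp
  have lhs: "fps_nth (fps_nth (Phi2 {matJ, matO}) k) n = of_nat (phi k n {matJ, matO}) / (fact k * fact n)"
    by (simp add: Phi2_def)
  note coeffs = lhs one monomials exponentials nth_numeral_mult fps_add_nth fps_sub_nth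
  have zero: "phi 0 n {matJ, matO} = (if n = 0 then 1 else 0)" "phi n 0 {matJ, matO} = (if n = 0 then 1 else 0)" for n
    by (simp_all add: phi_def)
  have one_row: "of_nat (phi 1 m {matJ, matO}) = (2 ^ m :: rat)"
    "of_nat (phi m 1 {matJ, matO}) = (2 ^ m :: rat)" if "m > 0" for m
    using that phi_commute[of m 1] by (simp_all only: phi_1 of_nat_power of_nat_numeral)
  have two_rows: "of_nat (phi 2 m {matJ, matO}) = (2 ^ m * (of_nat m ^ 2 + 3 * of_nat m + 4) / 4 :: rat)"
    "of_nat (phi m 2 {matJ, matO}) = (2 ^ m * (of_nat m ^ 2 + 3 * of_nat m + 4) / 4 :: rat)" if "m > 0" for m
  proof -
    have "of_nat (4 * phi 2 m {matJ, matO}) = (of_nat (2 ^ m * (m\<^sup>2 + 3 * m + 4)) :: rat)"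
      using that by (simp only: phi_2)
    thus "of_nat (phi 2 m {matJ, matO}) = (2 ^ m * (of_nat m ^ 2 + 3 * of_nat m + 4) / 4 :: rat)"
      by simp
    thus "of_nat (phi m 2 {matJ, matO}) = (2 ^ m * (of_nat m ^ 2 + 3 * of_nat m + 4) / 4 :: rat)"
      by (simp only: phi_commute[of m 2])
  qed
  consider "k = 0" | "n = 0" "k \<noteq> 0" | "k = 1" "n \<noteq> 0" | "n = 1" "k \<noteq> 0" "k \<noteq> 1"
    | "k = 2" "n \<noteq> 0" "n \<noteq> 1" | "n = 2" "k \<noteq> 0" "k \<noteq> 1" "k \<noteq> 2" | "k \<ge> 3" "n \<ge> 3"
    by linarith
  thus ?case
  proof cases
    case 1
    thus ?thesis unfolding x_def y_def coeffs by (auto simp: zero fact_numeral)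
  next
    case 2
    thus ?thesis unfolding x_def y_def coeffs by (auto simp: zero fact_numeral)
  next
    case 3
    thus ?thesis unfolding x_def y_def coeffs by (auto simp: one_row[simplified] fact_numeral)
  next
    case 4
    thus ?thesis unfolding x_def y_def coeffs by (auto simp: one_row[simplified] fact_numeral)
  next
    case 5
    thus ?thesis unfolding x_def y_def coeffs by (auto simp: two_rows fact_numeral)
  next
    case 6
    thus ?thesis unfolding x_def y_def coeffs by (auto simp: two_rows fact_numeral)
  next
    case 7
    consider "6 < k \<or> 6 < n \<or> (4 < k \<and> 4 < n)"
      | "k \<in> {3, 4}" "n \<in> {3, 4, 5, 6}" | "k \<in> {5, 6}" "n \<in> {3, 4}"
      using 7 by fastforce
    thus ?thesis
    proof cases
      case 1
      thus ?thesis using 7 unfolding x_def y_def coeffs by (auto simp: phi_eq_0)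
    next
      case 2
      thus ?thesis unfolding x_def y_def coeffs by (auto simp: phi_table phi_commute[of 4 3] fact_numeral)
    next
      case 3
      thus ?thesis unfolding x_def y_def coeffs by (auto simp: phi_table phi_commute[of 5] phi_commute[of 6] fact_numeral)
    qed
  qed
next
  case 2
  have small: "phi 0 0 {matJ, matO} = 1" "phi (Suc 0) (Suc 0) {matJ, matO} = 2" "phi 2 2 {matJ, matO} = 14"
    using phi_1[of 1] phi_2[of 2] by (simp_all add: phi_def)
  show ?case
    unfolding z_def
  proof (rule fps_ext)
    fix n :: nat
    consider "n = 0" | "n = 1" | "n = 2" | "n = 3" | "n = 4" | "n \<ge> 5"
      by linarith
    thus "fps_nth (Phi1 {matJ, matO}) n =
        fps_nth (1 + 2 * fps_X + 7 * fps_X ^ 2 + 26 * fps_X ^ 3 + 35 * fps_X ^ 4) n"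
      by cases (auto simp: Phi1_def small phi_table phi_eq_0 numeral_fps_const fact_numeral)
  qed
qed

end
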